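(* A polynomial $u\in\mathbb{Z}[x]$ is nilpotent at $3$ (that is, $u\in N_3$) if and only if it has one of the following forms for some $p(x)\in\mathbb{Z}[x]$, and in each case the index of nilpotency at $3$ and the associated finite sequence at $3$ are as stated: (1) $(x-3)p(x)$ (index $1$, associated finite sequence $3,0$); (2) $2(x-2)+p(x)(x-2)(x-3)$ (index $2$, associated finite sequence $3,2,0$); (3) $-2(x-6)+p(x)(x-3)(x-6)$ (index $2$, associated finite sequence $3,6,0$); (4) $-4(x-4)+p(x)(x-3)(x-4)$ (index $2$, associated finite sequence $3,4,0$); (5) $x-1+p(x)(x-1)(x-2)(x-3)$ (index $3$, associated finite sequence $3,2,1,0$); (6) $-(3x-13)(x-2)+p(x)(x-2)(x-3)(x-4)$ (index $3$, associated finite sequence $3,4,2,0$); (7) $-(x-5)(3x-7)+p(x)(x-3)(x-4)(x-5)$ (index $3$, associated finite sequence $3,4,5,0$); (8) $-2(x-4)+p(x)(x-2)(x-3)(x-4)$ (index $3$, associated finite sequence $3,2,4,0$).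
   Context: $\mathbb{N}$ is the set of positive integers. For $u\in\mathbb{Z}[x]$ and $n\in\mathbb{N}$, $u^{(n)}$ denotes the $n$-fold composition $u\circ\cdots\circ u$. For $r\in\mathbb{Z}$, $u$ is called nilpotent at $r$ if there is $n\in\mathbb{N}$ with $u^{(n)}(r)=0$; the smallest such $n$ is called the index (of nilpotency) of $u$ at $r$. The zero polynomial is nilpotent at every $r$ with index $1$. $N_r$ denotes the set of all $u\in\mathbb{Z}[x]$ nilpotent at $r$. If $u$ is nilpotent at $r$ of index $m$, the finite sequence associated to $u$ at $r$ is $r,u(r),\ldots,u^{(m-1)}(r),0$. *)

theory Defs
  imports "HOL-Computational_Algebra.Polynomial"
begin

abbreviation X :: "int poly" where
  "X \<equiv> [:0, 1:]"

text \<open>Positive integers are rendered as \<^typ>\<open>nat\<close> with an explicit \<open>n > 0\<close>. The value at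
  \<open>n = 0\<close>, namely \<open>x\<close>, only serves to produce the initial entry \<open>r\<close> of the associated sequence.\<close>

definition iterate_poly :: "int poly \<Rightarrow> nat \<Rightarrow> int poly" where
  "iterate_poly u n = (pcompose u ^^ n) X"

definition nilpotent_at :: "int poly \<Rightarrow> int \<Rightarrow> bool" where
  "nilpotent_at u r \<longleftrightarrow> (\<exists>n>0. poly (iterate_poly u n) r = 0)"

definition nilpotent_set :: "int \<Rightarrow> int poly set" where
  "nilpotent_set r = {u. nilpotent_at u r}"

text \<open>The next two functions are meaningful only if \<open>u\<close> is nilpotent at \<open>r\<close>.\<close>

definition nilpotency_index :: "int poly \<Rightarrow> int \<Rightarrow> nat" where
  "nilpotency_index u r = (LEAST n. n > 0 \<and> poly (iterate_poly u n) r = 0)"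

definition associated_seq :: "int poly \<Rightarrow> int \<Rightarrow> int list" where
  "associated_seq u r =
     map (\<lambda>i. poly (iterate_poly u i) r) [0..<nilpotency_index u r] @ [0]"

end

theory Submission
  imports Defs
begin

text \<open>An integer polynomial satisfies \<open>a - b dvd u(a) - u(b)\<close>, so along an orbit
  \<open>f 0, f 1, \<dots>\<close> of \<open>u\<close> each difference \<open>f j - f i\<close> divides its shift
  \<open>f (j + k) - f (i + k)\<close>. If \<open>f m = 0\<close> for the first time at \<open>m\<close>, then the points
  \<open>f 0, \<dots>, f m\<close> are distinct and every step \<open>f (i + 1) - f i\<close> divides \<open>f i\<close> and the last
  nonzero entry \<open>L = f (m - 1)\<close>. For \<open>f 0 = 3\<close> the first step divides \<open>3\<close>, and
  \<open>L - 3\<close> divides \<open>f 1\<close>, so there are finitely many pairs \<open>(f 1, L)\<close>; in each of them the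
  divisibilities determine the orbit. Newton interpolation turns orbits into
  polynomials; it also excludes the orbit \<open>3, 6, 9, 0\<close>, which passes all the
  pairwise divisibility tests.\<close>

section \<open>Divisibility along orbits\<close>

lemma poly_factor_root:
  fixes w :: "int poly"
  assumes "poly w a = 0"
  obtains q where "w = (X - of_int a) * q"
proof -
  have "[:- a, 1:] dvd w"
    using assms by (simp add: poly_eq_0_iff_dvd)
  moreover have "[:- a, 1:] = X - of_int a"
    by (simp add: of_int_poly)
  ultimately show thesis
    using that by (metis dvdE)
qed

text \<open>Subtracting the constant \<open>u(b)\<close> makes \<open>b\<close> a root, and the
  cofactor of \<open>X - b\<close>, evaluated at \<open>a\<close>, is the quotient.\<close>

lemma diff_dvd_poly_diff:
  fixes u :: "int poly"
  shows "a - b dvd poly u a - poly u b"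
proof -
  have "poly (u - of_int (poly u b)) b = 0"
    by (simp add: of_int_poly)
  then obtain q where "u - of_int (poly u b) = (X - of_int b) * q"
    by (rule poly_factor_root)
  then have "poly (u - of_int (poly u b)) a = poly ((X - of_int b) * q) a"
    by simp
  then have "poly u a - poly u b = (a - b) * poly q a"
    by (simp add: of_int_poly algebra_simps)
  then show ?thesis
    by simp
qed

abbreviation orbit :: "int poly \<Rightarrow> int \<Rightarrow> nat \<Rightarrow> int" where
  "orbit u r n \<equiv> (poly u ^^ n) r"

lemma poly_iterate_poly: "poly (iterate_poly u n) r = orbit u r n"
  by (induction n) (simp_all add: iterate_poly_def poly_pcompose)

text \<open>Applying \<open>u\<close> once more replaces a difference by a multiple of it, so
  induction on the shift suffices.\<close>

lemma orbit_diff_dvd: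
  "orbit u r j - orbit u r i dvd orbit u r (j + k) - orbit u r (i + k)"
proof (induction k)
  case (Suc k)
  show ?case
    using dvd_trans[OF Suc.IH diff_dvd_poly_diff[of _ _ u]] by simp
qed simp

lemma orbit_step_dvd_step:
  assumes "i \<le> j"
  shows "orbit u r (Suc i) - orbit u r i dvd orbit u r (Suc j) - orbit u r j"
  using orbit_diff_dvd[of "Suc i" u r i "j - i"] assms by simp

text \<open>The difference telescopes into steps with index at least \<open>i\<close>, each a
  multiple of step \<open>i\<close>.\<close>

lemma orbit_step_dvd_diff:
  assumes "i \<le> j" "j \<le> k"
  shows "orbit u r (Suc i) - orbit u r i dvd orbit u r k - orbit u r j"
  using assms(2)
proof (induction k rule: dec_induct)
  case (step n)
  have "orbit u r (Suc i) - orbit u r i dvd orbit u r (Suc n) - orbit u r n"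
    using orbit_step_dvd_step assms(1) step.hyps by simp
  then show ?case
    using dvd_add[OF step.IH] by fastforce
qed simp

lemma orbit_shift_eq:
  assumes "orbit u r i = orbit u r j"
  shows "orbit u r (i + k) = orbit u r (j + k)"
  using assms by (simp add: add.commute[of _ k] funpow_add)

text \<open>If entries \<open>i < j\<close> agreed, shifting both by \<open>m - j\<close> would
  produce a zero at the index \<open>i + (m - j)\<close>, which is below \<open>m\<close>.\<close>

lemma orbit_inj:
  assumes zero: "orbit u r m = 0" and nonzero: "\<forall>i<m. orbit u r i \<noteq> 0"
    and eq: "orbit u r i = orbit u r j" and "i \<le> m" "j \<le> m"
  shows "i = j"
proof -
  have "\<not> i < j" if "orbit u r i = orbit u r j" "j \<le> m" for i j
  proof
    assume "i < j"
    have "orbit u r (i + (m - j)) = orbit u r (j + (m - j))"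
      using that(1) by (rule orbit_shift_eq)
    then show False
      using zero nonzero that(2) \<open>i < j\<close> by auto
  qed
  from this[OF eq] this[OF eq[symmetric]] show ?thesis
    using assms(4,5) by simp
qed

lemma orbit_step_dvd_entry:
  assumes "orbit u r m = 0" "i \<le> j" "j \<le> m"
  shows "orbit u r (Suc i) - orbit u r i dvd orbit u r j"
  using orbit_step_dvd_diff[OF assms(2,3), of u r] assms(1) by simp

text \<open>All steps from \<open>i\<close> on have the same size, and by injectivity the same sign.\<close>

lemma orbit_arithmetic_end:
  assumes zero: "orbit u r m = 0" and nonzero: "\<forall>i<m. orbit u r i \<noteq> 0"
    and step: "\<bar>orbit u r (Suc i) - orbit u r i\<bar> = \<bar>orbit u r (m - 1)\<bar>"
    and "k \<le> m - i" "i < m"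
  shows "orbit u r (m - k) = int k * orbit u r (m - 1)"
  using assms(4)
\<comment> \<open>Counting back from the zero at \<open>m\<close>, two known entries are needed: the
  sign of the next step is found by comparison with the entry two places later.\<close>
proof (induction k rule: induct_nat_012)
  case (ge2 k)
  define f where "f = orbit u r"
  define j where "j = m - Suc (Suc k)"
  define L where "L = f (m - 1)"
  have j: "i \<le> j" "m - Suc k = Suc j" "m - k = Suc (Suc j)" "j \<le> m - 1" "Suc (Suc j) \<le> m"
    using ge2.prems assms(5) by (simp_all add: j_def)
  have "f (Suc i) - f i dvd f (Suc j) - f j"
    unfolding f_def using j(1) by (rule orbit_step_dvd_step)
  moreover have "L dvd f (Suc i) - f i"
    using step unfolding f_def L_def by (metis abs_dvd_iff dvd_abs_iff dvd_refl)
  ultimately have "L dvd f (Suc j) - f j"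
    by (metis dvd_trans)
  moreover have "f (Suc j) - f j dvd L"
    unfolding f_def L_def using zero j(4) by (rule orbit_step_dvd_entry) simp
  ultimately have "\<bar>f (Suc j) - f j\<bar> = \<bar>L\<bar>"
    by (metis zdvd_antisym_abs)
  then have "f (Suc j) - f j = L \<or> f (Suc j) - f j = - L"
    by arith
  \<comment> \<open>Of the two signs, one would bring the orbit back to \<open>f j\<close> after two
    steps.\<close>
  moreover have "f j \<noteq> f (Suc (Suc j))"
    unfolding f_def using orbit_inj[OF zero nonzero, of j "Suc (Suc j)"] j(5) by auto
  moreover have "f (Suc j) = int k * L + L" "f (Suc (Suc j)) = int k * L"
    using ge2 j unfolding f_def L_def by (simp_all add: distrib_right del: funpow.simps)
  ultimately have "f j = int k * L + 2 * L"
    by auto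
  then show ?case
    unfolding f_def L_def j_def by (simp add: algebra_simps)
qed (use zero in simp_all)

section \<open>Orbits from 3 to 0\<close>

lemma int_divisors:
  fixes d :: int
  shows "d dvd 1 \<Longrightarrow> d \<in> {1, -1}"
    and "d dvd 2 \<Longrightarrow> d \<in> {1, -1, 2, -2}"
    and "d dvd 3 \<Longrightarrow> d \<in> {1, -1, 3, -3}"
    and "d dvd 4 \<Longrightarrow> d \<in> {1, -1, 2, -2, 4, -4}"
    and "d dvd 5 \<Longrightarrow> d \<in> {1, -1, 5, -5}"
    and "d dvd 6 \<Longrightarrow> d \<in> {1, -1, 2, -2, 3, -3, 6, -6}"
proof -
  have range: "-6 \<le> d \<and> d \<le> 6" if "d dvd n" "0 < n" "n \<le> 6" for n :: int
    using dvd_imp_le_int[of n d] that by auto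
  have cases: "d = -6 \<or> d = -5 \<or> d = -4 \<or> d = -3 \<or> d = -2 \<or> d = -1 \<or> d = 0
      \<or> d = 1 \<or> d = 2 \<or> d = 3 \<or> d = 4 \<or> d = 5 \<or> d = 6" if "-6 \<le> d \<and> d \<le> 6"
    using that by arith
  show "d dvd 1 \<Longrightarrow> d \<in> {1, -1}" by auto
  show "d dvd 2 \<Longrightarrow> d \<in> {1, -1, 2, -2}"
    using range[of 2] cases by fastforce
  show "d dvd 3 \<Longrightarrow> d \<in> {1, -1, 3, -3}"
    using range[of 3] cases by fastforce
  show "d dvd 4 \<Longrightarrow> d \<in> {1, -1, 2, -2, 4, -4}"
    using range[of 4] cases by fastforce
  show "d dvd 5 \<Longrightarrow> d \<in> {1, -1, 5, -5}"
    using range[of 5] cases by fastforce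
  show "d dvd 6 \<Longrightarrow> d \<in> {1, -1, 2, -2, 3, -3, 6, -6}"
    using range[of 6] cases by fastforce
qed

text \<open>A second divided difference fails to be integral: the quotient of \<open>u - 6\<close>
  by \<open>X - 3\<close> takes the values 1 at 6 and -1 at 9, yet 9 - 6 does not divide -2.\<close>

lemma no_orbit_3_6_9_0:
  fixes u :: "int poly"
  assumes "poly u 3 = 6" "poly u 6 = 9"
  shows "poly u 9 \<noteq> 0"
proof
  assume "poly u 9 = 0"
  have "poly (u - 6) 3 = 0"
    using assms by simp
  then obtain q where q: "u - 6 = (X - of_int 3) * q"
    by (rule poly_factor_root)
  have "poly (u - 6) x = (x - 3) * poly q x" for x
    by (simp add: q)
  from this[of 6] this[of 9] have "poly q 6 = 1" "poly q 9 = -1"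
    using assms \<open>poly u 9 = 0\<close> by auto
  then show False
    using diff_dvd_poly_diff[of 9 6 q] by simp
qed

lemma orbit_from_3:
  fixes u :: "int poly"
  defines "f \<equiv> orbit u 3"
  assumes zero: "f m = 0" and nonzero: "\<forall>i<m. f i \<noteq> 0"
  shows "m = 1 \<or> (m = 2 \<and> f 1 \<in> {2, 4, 6})
    \<or> (m = 3 \<and> (f 1, f 2) \<in> {(2, 1), (2, 4), (4, 2), (4, 5)})"
proof (cases "m \<le> 1")
  case True
  have "f 0 = 3" by (simp add: f_def)
  with True zero show ?thesis
    by (cases m) auto
next
  case False
  define L where "L = f (m - 1)"
  have f0: "f 0 = 3" by (simp add: f_def)
  have inj: "i = j" if "f i = f j" "i \<le> m" "j \<le> m" for i j
    using orbit_inj zero nonzero that unfolding f_def by blast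
  have dvd: "f j - f i dvd f (j + k) - f (i + k)" for i j k
    unfolding f_def by (rule orbit_diff_dvd)
  have step: "f (Suc i) - f i dvd f j" if "i \<le> j" "j \<le> m" for i j
    using orbit_step_dvd_entry zero that unfolding f_def by blast
  have chain: "f (Suc i) - f i dvd f (Suc j) - f j" if "i \<le> j" for i j
    using orbit_step_dvd_step that unfolding f_def by blast
  \<comment> \<open>A step as large as \<open>L\<close> forces an arithmetic progression from there
    down to 0.\<close>
  have run: "f i = int (m - i) * L" if "\<bar>f (Suc i) - f i\<bar> = \<bar>L\<bar>" "i < m" for i
    using orbit_arithmetic_end[where u = u and r = 3 and m = m and i = i and k = "m - i"]
      zero nonzero that
    unfolding f_def L_def by simp
  have f1: "f 1 \<in> {2, 4, 6}"
  proof -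
    have "f 1 - 3 dvd 3"
      using step[of 0 0] f0 by simp
    moreover have "f 1 \<noteq> 0"
      using nonzero False by simp
    ultimately show ?thesis
      using int_divisors(3)[of "f 1 - 3"] by auto
  qed
  have L0: "L \<noteq> 0"
    using nonzero False by (simp add: L_def)
  \<comment> \<open>Shifting the indices 0 and \<open>m - 1\<close> by one turns
    \<open>L - 3\<close> into \<open>0 - f 1\<close>.\<close>
  have L_dvd: "L - 3 dvd f 1"
    using dvd[of "m - 1" 0 1] f0 zero False by (simp add: L_def)
  have L_last: "i = m - 1" if "f i = L" "i < m" for i
    using inj[of i "m - 1"] that by (simp add: L_def)
  have step_L: "f (Suc i) - f i dvd L" if "i < m" for i
    using step[of i "m - 1"] that by (simp add: L_def)
  show ?thesis
  proof (cases "m = 2")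
    case True
    with f1 show ?thesis by simp
  next
    case m2: False
    with False have m: "3 \<le> m" by simp
    have L1: "L \<noteq> f 1"
      using L_last[of 1] m by auto
    have L2: "m = 3" if "f 2 = L"
      using L_last[of 2] m that by auto
    have f2: "f 2 \<noteq> 3" "f 2 \<noteq> f 1" "f 2 \<noteq> 0"
      using inj[of 2 0] inj[of 2 1] nonzero m f0 by auto
    have d1: "f 2 - f 1 dvd f 1" "f 2 - f 1 dvd L"
      using step[of 1 1] step_L[of 1] m by (simp_all add: numeral_2_eq_2)
    from f1 consider "f 1 = 2" | "f 1 = 4" | "f 1 = 6"
      by auto
    then show ?thesis
    proof cases
      case 1
      have "f 2 \<in> {1, 4}"
        using int_divisors(2)[of "f 2 - 2"] d1 1 f2 by auto
      then consider "f 2 = 1" | "f 2 = 4"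
        by auto
      then show ?thesis
      proof cases
        case f2': 1
        \<comment> \<open>Otherwise \<open>f 3 - 1\<close> divides 1, so \<open>f 3\<close> is 2, a
          repetition of \<open>f 1\<close>, or an early 0.\<close>
        have "m = 3"
        proof (rule ccontr)
          assume "m \<noteq> 3"
          with m have "4 \<le> m" by simp
          then have "f 3 - 1 dvd 1" "f 3 \<noteq> 0" "f 3 \<noteq> 2"
            using step[of 2 2] nonzero inj[of 3 1] 1 f2' by (auto simp: numeral_3_eq_3)
          then show False
            using int_divisors(1)[of "f 3 - 1"] by auto
        qed
        with 1 f2' show ?thesis by simp
      next
        case f2': 2
        have "L \<in> {4, 5, 1}"
          using int_divisors(2)[of "L - 3"] L_dvd 1 L1 by auto
        \<comment> \<open>The step from 2 to 4 makes \<open>L\<close> even, which leaves only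
          4.\<close>
        with d1 f2' 1 have "f 2 = L"
          by auto
        with L2 1 f2' show ?thesis by simp
      qed
    next
      case 2
      have L: "L \<in> {2, 5, 1, 7, -1}"
        using int_divisors(4)[of "L - 3"] L_dvd 2 L1 by auto
      have "f 2 \<in> {5, 6, 2, 8}"
        using int_divisors(4)[of "f 2 - 4"] d1 2 f2 by auto
      then consider "f 2 = 5" | "f 2 = 6" | "f 2 = 2" | "f 2 = 8"
        by auto
      then show ?thesis
      proof cases
        case f2': 1
        \<comment> \<open>The indices 0 and \<open>m - 2\<close> are shifted by two, onto
          \<open>f 2 = 5\<close> and \<open>f m = 0\<close>.\<close>
        have d: "f (m - 2) - 3 dvd 5"
        proof -
          have "f (m - 2) - f 0 dvd f (m - 2 + 2) - f (0 + 2)"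
            by (rule dvd)
          moreover have "m - 2 + 2 = m" "0 + 2 = (2::nat)"
            using m by simp_all
          ultimately show ?thesis
            using f0 zero f2' by (simp add: numeral_2_eq_2)
        qed
        from L consider "L = 5" | "L = 1 \<or> L = -1" | "L = 2" | "L = 7"
          by auto
        then show ?thesis
        proof cases
          case 1
          with L2 2 f2' show ?thesis by simp
        next
          case L': 2
          \<comment> \<open>The first step has size 1, equal to that of \<open>L\<close>. The
            progression would be 3, 2, 1, 0, contrary to \<open>f 2 = 5\<close>.\<close>
          have "3 = int m * L"
            using run[of 0] f0 2 L' m by auto
          with L' have "m = 3" "L = 1"
            by auto
          then show ?thesis
            using L_def f2' by simp
        next
          case L': 3
          have "m \<noteq> 3"
            using L' f2' by (auto simp: L_def)
          have "f (m - 2) \<in> {4, 2, 8, -2}"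
            using int_divisors(5)[OF d] by auto
          moreover have "f (m - 2) \<noteq> 2"
            using L_last[of "m - 2"] L' m by auto
          moreover have "f (m - 2) \<noteq> 4"
            using inj[of "m - 2" 1] \<open>m \<noteq> 3\<close> m 2 by auto
          \<comment> \<open>The step into \<open>L\<close> divides \<open>L\<close>; the remaining
            candidates 8 and -2 give -6 and 4, neither of which divides 2.\<close>
          moreover have "2 - f (m - 2) dvd 2"
            using step_L[of "m - 2"] m L' L_def by (simp add: Suc_diff_le[symmetric])
          ultimately show ?thesis by auto
        next
          case L': 4
          have "m \<noteq> 3"
            using L' f2' by (auto simp: L_def)
          with m have "4 \<le> m" by simp
          \<comment> \<open>Coprime multiples force steps of size 1, here and at the next entry, and
            injectivity makes them positive. This leads to 3, 4, 5, 6, 7, 0.\<close>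
          then have "f 3 - 5 dvd 5" "f 3 - 5 dvd 7" "f 3 \<noteq> 4"
            using step[of 2 2] step_L[of 2] inj[of 3 1] 2 f2' L' by (auto simp: numeral_3_eq_3)
          then have f3: "f 3 = 6"
            using int_divisors(5)[of "f 3 - 5"] by auto
          have "m \<noteq> 4"
            using L' f3 by (auto simp: L_def)
          with \<open>4 \<le> m\<close> have "5 \<le> m" by simp
          then have "f 4 - 6 dvd 6" "f 4 - 6 dvd 7" "f 4 \<noteq> 5"
            using step[of 3 3] step_L[of 3] inj[of 4 2] f3 f2' L' by (auto simp: eval_nat_numeral)
          then have "f 4 = L"
            using int_divisors(6)[of "f 4 - 6"] L' by auto
          then have "m = 5"
            using L_last[of 4] \<open>5 \<le> m\<close> by auto
          then show ?thesis
            \<comment> \<open>Here \<open>f 3 - f 0 = 3\<close> would divide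
              \<open>f 5 - f 2 = -5\<close>.\<close>
            using dvd[of 3 0 2] f0 f3 f2' zero by (simp add: numeral_2_eq_2)
        qed
      next
        case f2': 2
        with d1 2 L have "L = 2" by auto
        \<comment> \<open>The step from 4 to 6 has the size of \<open>L\<close>, so
          \<open>4 = (m - 1) * 2\<close>; but then \<open>L\<close> is
          \<open>f 2 = 6\<close>.\<close>
        then have "m = 3"
          using run[of 1] m 2 f2' by (simp add: numeral_2_eq_2)
        then show ?thesis
          using L_def f2' \<open>L = 2\<close> by simp
      next
        case f2': 3
        with d1 2 L have "L = 2" by auto
        with L2 2 f2' show ?thesis by simp
      next
        case f2': 4
        with d1 2 L show ?thesis by auto
      qed
    next
      case 3
      have "3 dvd L"
        using step_L[of 0] m 3 f0 by simp
      then have "L = 9 \<or> L = -3"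
        using int_divisors(6)[of "L - 3"] L_dvd 3 L1 L0 by auto
      then show ?thesis
      proof
        assume L: "L = 9"
        \<comment> \<open>Since \<open>f 2 - 6\<close> also divides both 6 and 9, it is 3 or -3, and
          -3 would return to the start.\<close>
        have "3 dvd f 2 - 6"
          using chain[of 0 1] 3 f0 by (simp add: numeral_2_eq_2)
        then have "f 2 = 9"
          using int_divisors(6)[of "f 2 - 6"] d1 L 3 f2 by auto
        with L2 L have "m = 3" by simp
        then show ?thesis
          using no_orbit_3_6_9_0[of u] \<open>f 2 = 9\<close> 3 zero
          by (simp add: f_def eval_nat_numeral)
      next
        assume "L = -3"
        \<comment> \<open>The first step has the size of \<open>L\<close>, so 3 would equal
          \<open>m * (-3)\<close>, which has the wrong sign.\<close>
        then show ?thesis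
          using run[of 0] m 3 f0 by simp
      qed
    qed
  qed
qed

section \<open>From orbits to polynomials\<close>

text \<open>Newton interpolation: once \<open>X - a\<close> is split off from \<open>u - v\<close>,
  the quotient still vanishes at \<open>b\<close> because \<open>b - a\<close> is nonzero.\<close>

lemma poly_interpolate_2:
  fixes u v :: "int poly"
  assumes "poly u a = poly v a" "poly u b = poly v b" "a \<noteq> b"
  shows "\<exists>p. u = v + p * (X - of_int a) * (X - of_int b)"
proof -
  have "poly (u - v) a = 0"
    using assms by simp
  then obtain q where q: "u - v = (X - of_int a) * q"
    by (rule poly_factor_root)
  have "poly (u - v) b = (b - a) * poly q b"
    by (simp add: q of_int_poly left_diff_distrib)
  with assms have "poly q b = 0"
    by simp
  then obtain p where "q = (X - of_int b) * p"
    by (rule poly_factor_root)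
  with q have "u - v = p * (X - of_int a) * (X - of_int b)"
    by (simp only: ac_simps)
  then have "u = v + p * (X - of_int a) * (X - of_int b)"
    by (simp only: diff_eq_eq add.commute)
  then show ?thesis ..
qed

lemma poly_interpolate_3:
  fixes u v :: "int poly"
  assumes "poly u a = poly v a" "poly u b = poly v b" "poly u c = poly v c" "distinct [a, b, c]"
  shows "\<exists>p. u = v + p * (X - of_int a) * (X - of_int b) * (X - of_int c)"
proof -
  obtain q where q: "u = v + q * (X - of_int a) * (X - of_int b)"
    using poly_interpolate_2[of u a v b] assms by auto
  have "poly u c = poly v c + poly q c * (c - a) * (c - b)"
    by (subst q) (simp add: of_int_poly algebra_simps)
  with assms have "poly q c = 0"
    by auto
  then obtain p where "q = (X - of_int c) * p"
    by (rule poly_factor_root)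
  with q have "u = v + p * (X - of_int a) * (X - of_int b) * (X - of_int c)"
    by (simp only: ac_simps)
  then show ?thesis ..
qed

section \<open>Index and associated sequence from values of the polynomial\<close>

lemma nilpotent_at_iff: "nilpotent_at u r \<longleftrightarrow> (\<exists>n>0. orbit u r n = 0)"
  by (simp add: nilpotent_at_def poly_iterate_poly)

lemma nilpotency_index_eqI:
  assumes "0 < n" "orbit u r n = 0" "\<And>i. 0 < i \<Longrightarrow> i < n \<Longrightarrow> orbit u r i \<noteq> 0"
  shows "nilpotency_index u r = n"
  unfolding nilpotency_index_def poly_iterate_poly
  by (rule Least_equality) (use assms in \<open>auto simp: not_less[symmetric]\<close>)

lemma associated_seq_1:
  assumes "poly u r = 0"
  shows "nilpotent_at u r \<and> nilpotency_index u r = 1 \<and> associated_seq u r = [r, 0]"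
proof -
  have "nilpotency_index u r = 1"
    by (rule nilpotency_index_eqI) (use assms in auto)
  with assms show ?thesis
    by (auto simp: associated_seq_def poly_iterate_poly nilpotent_at_iff intro: exI[of _ 1])
qed

lemma associated_seq_2:
  assumes "poly u r = a" "a \<noteq> 0" "poly u a = 0"
  shows "nilpotent_at u r \<and> nilpotency_index u r = 2 \<and> associated_seq u r = [r, a, 0]"
proof -
  have "nilpotency_index u r = 2"
    by (rule nilpotency_index_eqI) (use assms in \<open>auto simp: less_Suc_eq numeral_2_eq_2\<close>)
  with assms show ?thesis
    by (auto simp: associated_seq_def poly_iterate_poly nilpotent_at_iff eval_nat_numeral
        intro!: exI[of _ 2])
qed

lemma associated_seq_3:
  assumes "poly u r = a" "a \<noteq> 0" "poly u a = b" "b \<noteq> 0" "poly u b = 0"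
  shows "nilpotent_at u r \<and> nilpotency_index u r = 3 \<and> associated_seq u r = [r, a, b, 0]"
proof -
  have "nilpotency_index u r = 3"
    by (rule nilpotency_index_eqI) (use assms in \<open>auto simp: less_Suc_eq numeral_3_eq_3\<close>)
  with assms show ?thesis
    by (auto simp: associated_seq_def poly_iterate_poly nilpotent_at_iff eval_nat_numeral
        intro!: exI[of _ 3])
qed

lemma nilpotent_at_3_values:
  assumes "nilpotent_at u 3"
  shows "poly u 3 = 0 \<or> (\<exists>a\<in>{2, 4, 6}. poly u 3 = a \<and> poly u a = 0)
    \<or> (\<exists>(a, b)\<in>{(2, 1), (2, 4), (4, 2), (4, 5)}. poly u 3 = a \<and> poly u a = b \<and> poly u b = 0)"
proof -
  \<comment> \<open>The minimum ranges over all \<open>n\<close>, including 0, so that every entry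
    before \<open>m\<close> is nonzero, as \<open>orbit_from_3\<close> requires.\<close>
  define m where "m = (LEAST n. orbit u 3 n = 0)"
  obtain n where "orbit u 3 n = 0"
    using assms nilpotent_at_iff by blast
  then have zero: "orbit u 3 m = 0"
    unfolding m_def by (rule LeastI)
  have "\<forall>i<m. orbit u 3 i \<noteq> 0"
    unfolding m_def by (intro allI impI) (rule not_less_Least)
  with zero have "m = 1 \<or> (m = 2 \<and> orbit u 3 1 \<in> {2, 4, 6})
      \<or> (m = 3 \<and> (orbit u 3 1, orbit u 3 2) \<in> {(2, 1), (2, 4), (4, 2), (4, 5)})"
    by (rule orbit_from_3)
  moreover have "orbit u 3 1 = poly u 3" "orbit u 3 2 = poly u (poly u 3)"
    "orbit u 3 3 = poly u (poly u (poly u 3))"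
    by (simp_all add: eval_nat_numeral)
  ultimately show ?thesis
    using zero by (elim disjE conjE) auto
qed

theorem theorem3p4:
  fixes u :: "int poly"
  shows "(u \<in> nilpotent_set 3 \<longleftrightarrow>
      (\<exists>p :: int poly.
         u = (X - 3) * p \<or>
         u = 2 * (X - 2) + p * (X - 2) * (X - 3) \<or>
         u = - 2 * (X - 6) + p * (X - 3) * (X - 6) \<or>
         u = - 4 * (X - 4) + p * (X - 3) * (X - 4) \<or>
         u = X - 1 + p * (X - 1) * (X - 2) * (X - 3) \<or>
         u = - (3 * X - 13) * (X - 2) + p * (X - 2) * (X - 3) * (X - 4) \<or>
         u = - (X - 5) * (3 * X - 7) + p * (X - 3) * (X - 4) * (X - 5) \<or>
         u = - 2 * (X - 4) + p * (X - 2) * (X - 3) * (X - 4)))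
    \<and> (\<forall>p :: int poly.
         (u = (X - 3) * p \<longrightarrow>
            nilpotency_index u 3 = 1 \<and> associated_seq u 3 = [3, 0]) \<and>
         (u = 2 * (X - 2) + p * (X - 2) * (X - 3) \<longrightarrow>
            nilpotency_index u 3 = 2 \<and> associated_seq u 3 = [3, 2, 0]) \<and>
         (u = - 2 * (X - 6) + p * (X - 3) * (X - 6) \<longrightarrow>
            nilpotency_index u 3 = 2 \<and> associated_seq u 3 = [3, 6, 0]) \<and>
         (u = - 4 * (X - 4) + p * (X - 3) * (X - 4) \<longrightarrow>
            nilpotency_index u 3 = 2 \<and> associated_seq u 3 = [3, 4, 0]) \<and>
         (u = X - 1 + p * (X - 1) * (X - 2) * (X - 3) \<longrightarrow>
            nilpotency_index u 3 = 3 \<and> associated_seq u 3 = [3, 2, 1, 0]) \<and>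
         (u = - (3 * X - 13) * (X - 2) + p * (X - 2) * (X - 3) * (X - 4) \<longrightarrow>
            nilpotency_index u 3 = 3 \<and> associated_seq u 3 = [3, 4, 2, 0]) \<and>
         (u = - (X - 5) * (3 * X - 7) + p * (X - 3) * (X - 4) * (X - 5) \<longrightarrow>
            nilpotency_index u 3 = 3 \<and> associated_seq u 3 = [3, 4, 5, 0]) \<and>
         (u = - 2 * (X - 4) + p * (X - 2) * (X - 3) * (X - 4) \<longrightarrow>
            nilpotency_index u 3 = 3 \<and> associated_seq u 3 = [3, 2, 4, 0]))"
    (is "(_ \<longleftrightarrow> (\<exists>p. ?form p)) \<and> (\<forall>p. ?seq p)")
proof -
  \<comment> \<open>In each form the term with \<open>p\<close> vanishes at the nonzero entries of
    the orbit, so evaluation there does not depend on \<open>p\<close>.\<close>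
  have seq1: "nilpotent_at u 3 \<and> nilpotency_index u 3 = 1 \<and> associated_seq u 3 = [3, 0]"
    if "u = (X - 3) * p" for p
    by (rule associated_seq_1) (simp_all add: that)
  have seq2: "nilpotent_at u 3 \<and> nilpotency_index u 3 = 2 \<and> associated_seq u 3 = [3, 2, 0]"
    if "u = 2 * (X - 2) + p * (X - 2) * (X - 3)" for p
    by (rule associated_seq_2) (simp_all add: that)
  have seq3: "nilpotent_at u 3 \<and> nilpotency_index u 3 = 2 \<and> associated_seq u 3 = [3, 6, 0]"
    if "u = - 2 * (X - 6) + p * (X - 3) * (X - 6)" for p
    by (rule associated_seq_2) (simp_all add: that)
  have seq4: "nilpotent_at u 3 \<and> nilpotency_index u 3 = 2 \<and> associated_seq u 3 = [3, 4, 0]"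
    if "u = - 4 * (X - 4) + p * (X - 3) * (X - 4)" for p
    by (rule associated_seq_2) (simp_all add: that)
  have seq5: "nilpotent_at u 3 \<and> nilpotency_index u 3 = 3 \<and> associated_seq u 3 = [3, 2, 1, 0]"
    if "u = X - 1 + p * (X - 1) * (X - 2) * (X - 3)" for p
    by (rule associated_seq_3) (simp_all add: that)
  have seq6: "nilpotent_at u 3 \<and> nilpotency_index u 3 = 3 \<and> associated_seq u 3 = [3, 4, 2, 0]"
    if "u = - (3 * X - 13) * (X - 2) + p * (X - 2) * (X - 3) * (X - 4)" for p
    by (rule associated_seq_3) (simp_all add: that)
  have seq7: "nilpotent_at u 3 \<and> nilpotency_index u 3 = 3 \<and> associated_seq u 3 = [3, 4, 5, 0]"
    if "u = - (X - 5) * (3 * X - 7) + p * (X - 3) * (X - 4) * (X - 5)" for p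
    by (rule associated_seq_3) (simp_all add: that)
  have seq8: "nilpotent_at u 3 \<and> nilpotency_index u 3 = 3 \<and> associated_seq u 3 = [3, 2, 4, 0]"
    if "u = - 2 * (X - 4) + p * (X - 2) * (X - 3) * (X - 4)" for p
    by (rule associated_seq_3) (simp_all add: that)
  have "\<exists>p. ?form p" if "nilpotent_at u 3"
  proof -
    from nilpotent_at_3_values[OF that]
    consider "poly u 3 = 0"
      | "poly u 3 = 2" "poly u 2 = 0"
      | "poly u 3 = 6" "poly u 6 = 0"
      | "poly u 3 = 4" "poly u 4 = 0"
      | "poly u 3 = 2" "poly u 2 = 1" "poly u 1 = 0"
      | "poly u 3 = 4" "poly u 4 = 2" "poly u 2 = 0"
      | "poly u 3 = 4" "poly u 4 = 5" "poly u 5 = 0"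
      | "poly u 3 = 2" "poly u 2 = 4" "poly u 4 = 0"
      by auto
    then show ?thesis
    proof cases
      case 1
      then obtain p where "u = (X - of_int 3) * p"
        by (rule poly_factor_root)
      then have "u = (X - 3) * p"
        by simp
      then show ?thesis by blast
    next
      case 2
      then have "\<exists>p. u = 2 * (X - 2) + p * (X - 2) * (X - 3)"
        \<comment> \<open>In this and the following cases the comparison polynomial is the stated
          form at \<open>p = 0\<close>, and the nodes follow the order of its linear
          factors.\<close>
        using poly_interpolate_2[of u 2 "2 * (X - 2)" 3] by simp
      then show ?thesis by blast
    next
      case 3
      then have "\<exists>p. u = - 2 * (X - 6) + p * (X - 3) * (X - 6)"
        using poly_interpolate_2[of u 3 "- 2 * (X - 6)" 6] by simp
      then show ?thesis by blast
    next
      case 4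
      then have "\<exists>p. u = - 4 * (X - 4) + p * (X - 3) * (X - 4)"
        using poly_interpolate_2[of u 3 "- 4 * (X - 4)" 4] by simp
      then show ?thesis by blast
    next
      case 5
      then have "\<exists>p. u = X - 1 + p * (X - 1) * (X - 2) * (X - 3)"
        using poly_interpolate_3[of u 1 "X - 1" 2 3] by simp
      then show ?thesis by blast
    next
      case 6
      then have "\<exists>p. u = - (3 * X - 13) * (X - 2) + p * (X - 2) * (X - 3) * (X - 4)"
        using poly_interpolate_3[of u 2 "- (3 * X - 13) * (X - 2)" 3 4] by simp
      then show ?thesis by blast
    next
      case 7
      then have "\<exists>p. u = - (X - 5) * (3 * X - 7) + p * (X - 3) * (X - 4) * (X - 5)"
        using poly_interpolate_3[of u 3 "- (X - 5) * (3 * X - 7)" 4 5] by simp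
      then show ?thesis by blast
    next
      case 8
      then have "\<exists>p. u = - 2 * (X - 4) + p * (X - 2) * (X - 3) * (X - 4)"
        using poly_interpolate_3[of u 2 "- 2 * (X - 4)" 3 4] by simp
      then show ?thesis by blast
    qed
  qed
  moreover have "nilpotent_at u 3" if "\<exists>p. ?form p"
    using that seq1 seq2 seq3 seq4 seq5 seq6 seq7 seq8 by blast
  moreover have "\<forall>p. ?seq p"
    using seq1 seq2 seq3 seq4 seq5 seq6 seq7 seq8 by blast
  ultimately show ?thesis
    unfolding nilpotent_set_def mem_Collect_eq by blast
qed

end
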